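(* Let $n$ be an odd integer, $n\geq 3$, let $m=(n+1)/2$, and let $$f(i,j)=(m-i)(-1)^j+n(n-j)+m .$$ Then the $n\times n$ matrix $M=(M_{i,j})_{1\le i,j\le n}$ defined by $$M_{i,j}=\begin{cases} f\left(\frac{1}{2}(i+j),\ \frac{1}{2}(j-i)+m\right) & \text{if } i,j \text{ are of the same parity},\\[4pt] f\left(\left[\frac{1}{2}(i+j+n)\right]_n,\ \left[\frac{1}{2}(j-i+n)+m\right]_n\right) & \text{otherwise},\end{cases}$$ is a magic square of subtraction of order $n$ with residuum $\frac{n^2+1}{2}$.
   Context: For an integer $k$ and a positive integer $n$, $[k]_n=\big((k-1)\bmod n\big)+1$, where $\bmod\ n$ denotes the least nonnegative remainder, so $[k]_n\in\{1,2,\ldots,n\}$. For a vector $\mathbf{x}=(x_1,\ldots,x_n)$, let $\tilde{x}_1\geq\tilde{x}_2\geq\cdots\geq\tilde{x}_n$ be its entries sorted in decreasing order. The residuum of $\mathbf{x}$ is $\mathrm{res}(\mathbf{x})=\sum_{i=1}^n(-1)^{i+1}\tilde{x}_i=\tilde{x}_1-\tilde{x}_2+\tilde{x}_3-\cdots$. A magic square of subtraction of order $n$ (always understood to be normal) is an $n\times n$ array in which each of the integers $1,2,\ldots,n^2$ appears exactly once and such that all rows, all columns, and both diagonals (the main diagonal and the antidiagonal) have the same residuum. This common value is called the residuum of the square. *)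

theory Defs
  imports Main
begin

text \<open>The representative of \<open>k\<close> modulo \<open>n\<close> in \<open>{1..n}\<close>, for \<open>n > 0\<close>.\<close>

definition wrap :: "int \<Rightarrow> int \<Rightarrow> int" where
  "wrap n k = (k - 1) mod n + 1"

text \<open>Lists are indexed from 0, so the usual sign \<open>(-1)^(i+1)\<close> of the
  \<open>i\<close>-th largest entry becomes \<open>(-1)^i\<close>.\<close>

definition residuum :: "'a::linordered_idom list \<Rightarrow> 'a" where
  "residuum xs = (\<Sum>i<length xs. (- 1) ^ i * rev (sort xs) ! i)"

text \<open>An \<open>n \<times> n\<close> array is a function of which only the values
  at indices in \<open>{1..n} \<times> {1..n}\<close> matter.\<close>

definition lines_of :: "int \<Rightarrow> (int \<Rightarrow> int \<Rightarrow> int) \<Rightarrow> int list set" where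
  "lines_of n A =
     {map (\<lambda>j. A i j) [1..n] | i. i \<in> {1..n}} \<union>
     {map (\<lambda>i. A i j) [1..n] | j. j \<in> {1..n}} \<union>
     {map (\<lambda>i. A i i) [1..n], map (\<lambda>i. A i (n + 1 - i)) [1..n]}"

definition magic_square_of_subtraction :: "int \<Rightarrow> (int \<Rightarrow> int \<Rightarrow> int) \<Rightarrow> bool" where
  "magic_square_of_subtraction n A \<longleftrightarrow>
     n \<ge> 1 \<and>
     bij_betw (\<lambda>(i, j). A i j) ({1..n} \<times> {1..n}) {1..n\<^sup>2} \<and>
     (\<exists>r. \<forall>x \<in> lines_of n A. residuum x = r)"

definition square_residuum :: "int \<Rightarrow> (int \<Rightarrow> int \<Rightarrow> int) \<Rightarrow> int" where
  "square_residuum n A = (THE r. \<forall>x \<in> lines_of n A. residuum x = r)"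

end

theory Submission
  imports Defs "HOL-Library.Multiset"
begin

text \<open>
  Put \<open>a \<equiv> (i + j) / 2\<close> and \<open>b \<equiv> (j - i) / 2 + m\<close> modulo \<open>n\<close>, where 2 is invertible, so that
  \<open>M i j = f a b\<close> with \<open>a, b \<in> {1..n}\<close>. The map \<open>f\<close> sends \<open>(a, b)\<close> into the \<open>b\<close>-th block, counted
  from above, of \<open>n\<close> consecutive numbers; hence \<open>M\<close> is bijective. Along a row, a column, or the
  antidiagonal, \<open>b\<close> runs through all blocks, so its parity gives the sign of the entry in the
  residuum. This sign cancels the one inside \<open>f\<close>, and the residuum depends on \<open>a\<close> only through
  the sum of its values, which is \<open>n m\<close> in each case. The main diagonal is the middle block.
\<close>

section \<open>Residuum of a list with known ranks\<close>

lemma int_interval_bij: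
  fixes p :: "int \<Rightarrow> int"
  assumes "inj_on p {1..n}" "\<And>j. j \<in> {1..n} \<Longrightarrow> p j \<in> {1..n}"
  shows "bij_betw p {1..n} {1..n}"
  using assms endo_inj_surj[of "{1..n}" p] by (simp add: bij_betw_def image_subset_iff)

text \<open>\<open>p j\<close> serves as the rank of \<open>h j\<close> in decreasing order, ties
  allowed, so the alternating sign can be read off the parity of \<open>p j\<close> without
  sorting.\<close>

lemma residuum_map_upto:
  fixes h :: "int \<Rightarrow> int"
  assumes p: "bij_betw p {1..n} {1..n}"
    and mono: "\<And>j k. j \<in> {1..n} \<Longrightarrow> k \<in> {1..n} \<Longrightarrow> p j < p k \<Longrightarrow> h k \<le> h j"
  shows "residuum (map h [1..n]) = (\<Sum>j\<in>{1..n}. (if odd (p j) then 1 else - 1) * h j)"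
proof -
  define q where "q = inv_into {1..n} p"
  have q: "bij_betw q {1..n} {1..n}"
    unfolding q_def by (rule bij_betw_inv_into[OF p])
  have pq: "p (q b) = b" and qn: "q b \<in> {1..n}" if "b \<in> {1..n}" for b
    using that p q by (auto simp: q_def bij_betw_inv_into_right bij_betw_def)
  \<comment> \<open>Entries by increasing rank, hence in decreasing order: the reverse of the sorted
    list.\<close>
  define ys where "ys = map (h \<circ> q) [1..n]"
  have upto: "mset [1..n] = mset_set {1..n}"
    using mset_set_set[of "[1..n]"] by simp
  have "mset ys = image_mset h (image_mset q (mset_set {1..n}))"
    by (simp add: ys_def multiset.map_comp upto)
  also have "image_mset q (mset_set {1..n}) = mset_set {1..n}"
    using q by (simp add: bij_betw_def image_mset_mset_set)
  finally have "mset ys = mset (map h [1..n])"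
    by (simp add: upto)
  moreover have "sorted (rev ys)"
  proof -
    have "ys ! j \<le> ys ! i" if "i \<le> j" "j < length ys" for i j
    proof (cases "i = j")
      case False
      then have "p (q (1 + int i)) < p (q (1 + int j))"
        using that by (auto simp: pq ys_def)
      then have "h (q (1 + int j)) \<le> h (q (1 + int i))"
        using that by (intro mono qn) (auto simp: ys_def)
      then show ?thesis using that by (auto simp: ys_def)
    qed auto
    then show ?thesis by (simp add: sorted_rev_iff_nth_mono)
  qed
  ultimately have "sort (map h [1..n]) = rev ys"
    by (intro properties_for_sort) auto
  then have "residuum (map h [1..n]) = (\<Sum>i<nat n. (- 1) ^ i * ys ! i)"
    by (simp add: residuum_def)
  also have "\<dots> = (\<Sum>i<nat n. (- 1) ^ i * h (q (1 + int i)))"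
    by (intro sum.cong) (auto simp: ys_def)
  \<comment> \<open>Positions start at 0 and ranks at 1, so even positions become odd ranks.\<close>
  also have "\<dots> = (\<Sum>b\<in>{1..n}. (if odd b then 1 else - 1) * h (q b))"
    by (rule sum.reindex_bij_witness[of _ "\<lambda>b. nat (b - 1)" "\<lambda>i. 1 + int i"])
       (auto simp: minus_one_power_iff)
  also have "\<dots> = (\<Sum>b\<in>{1..n}. (if odd (p (q b)) then 1 else - 1) * h (q b))"
    by (intro sum.cong) (auto simp: pq)
  also have "\<dots> = (\<Sum>j\<in>{1..n}. (if odd (p j) then 1 else - 1) * h j)"
    by (rule sum.reindex_bij_betw[OF q])
  finally show ?thesis .
qed

section \<open>Sums over an interval of odd length, and residues modulo \<open>n\<close>\<close>

lemma interval_odd_Suc: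
  "{1..2 * int (Suc k) + 1} = insert (2 * int k + 3) (insert (2 * int k + 2) {1..2 * int k + 1})"
  by auto

text \<open>One induction with \<open>n = 2 * k + 1\<close>, \<open>m = k + 1\<close>: the two new
  terms \<open>2 * k + 2\<close> and \<open>2 * k + 3\<close> have opposite signs and contribute 1
  to the signed sum.\<close>

lemma
  fixes n m :: int
  assumes "2 * m = n + 1" "m \<ge> 1"
  shows sum_signs: "(\<Sum>j\<in>{1..n}. (if odd j then 1 else - 1)) = (1 :: int)"
    and sum_signed: "(\<Sum>j\<in>{1..n}. (if odd j then 1 else - 1) * j) = m"
    and sum_interval: "(\<Sum>j\<in>{1..n}. j) = n * m"
proof -
  have *: "(\<Sum>j\<in>{1..2 * int k + 1}. (if odd j then 1 else - 1)) = (1 :: int) \<and>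
    (\<Sum>j\<in>{1..2 * int k + 1}. (if odd j then 1 else - 1) * j) = int k + 1 \<and>
    (\<Sum>j\<in>{1..2 * int k + 1}. j) = (2 * int k + 1) * (int k + 1)" for k
  proof (induction k)
    case (Suc k)
    then show ?case
      unfolding interval_odd_Suc by (simp add: algebra_simps)
  qed simp
  have "2 * int (nat (m - 1)) + 1 = n" "int (nat (m - 1)) + 1 = m"
    using assms by auto
  from *[of "nat (m - 1)", unfolded this] show "(\<Sum>j\<in>{1..n}. (if odd j then 1 else - 1)) = (1 :: int)"
    "(\<Sum>j\<in>{1..n}. (if odd j then 1 else - 1) * j) = m"
    "(\<Sum>j\<in>{1..n}. j) = n * m"
    by simp_all
qed

lemma int_interval_dvd_diff:
  fixes n :: int
  assumes "n dvd x - y" "x \<in> {1..n}" "y \<in> {1..n}"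
  shows "x = y"
  using assms zdvd_imp_le[of n "x - y"] zdvd_imp_le[of n "y - x"]
  by (cases x y rule: linorder_cases) (auto simp: dvd_diff_commute)

lemma wrap_props:
  assumes "n > 0"
  shows "wrap n k \<in> {1..n}" "n dvd wrap n k - k"
proof -
  show "wrap n k \<in> {1..n}"
    using assms by (auto simp: wrap_def add1_zle_eq)
  have "wrap n k - k = - (n * ((k - 1) div n))"
    using div_mult_mod_eq[of "k - 1" n] by (simp add: wrap_def algebra_simps)
  then show "n dvd wrap n k - k" by simp
qed

section \<open>The blocks of \<open>f\<close>, and residua across and inside them\<close>

locale subtraction_square =
  fixes n m :: int
  assumes m: "2 * m = n + 1" and n: "n \<ge> 3"
begin

text \<open>Solved for \<open>n\<close>, the assumption exposes that \<open>n\<close> is odd, hence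
  coprime to 2.\<close>

lemma n_eq: "n = 2 * m - 1"
  using m by simp

lemma m_ge: "m \<ge> 1"
  using m n by simp

definition f :: "int \<Rightarrow> int \<Rightarrow> int" where
  "f a b = (m - a) * (if odd b then - 1 else 1) + n * (n - b) + m"

text \<open>The offset is \<open>a\<close> for odd \<open>b\<close> and
  \<open>2 * m - a = n + 1 - a\<close> for even \<open>b\<close>.\<close>

lemma f_block:
  assumes "a \<in> {1..n}"
  shows "f a b - n * (n - b) \<in> {1..n}"
  using assms m by (auto simp: f_def)

text \<open>Consecutive blocks start \<open>n\<close> apart, which is also their length, so they do
  not overlap.\<close>

lemma f_antimono:
  assumes "a \<in> {1..n}" "a' \<in> {1..n}" "b < b'"
  shows "f a' b' < f a b"
proof -
  have "n * (n - b') + n \<le> n * (n - b)"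
    using mult_left_mono[of "n - b' + 1" "n - b" n] assms(3) n by (simp add: distrib_left)
  then show ?thesis
    using f_block[OF assms(1), of b] f_block[OF assms(2), of b'] by auto
qed

lemma f_inj:
  assumes "a \<in> {1..n}" "a' \<in> {1..n}" "f a b = f a' b'"
  shows "a = a'" "b = b'"
proof -
  show "b = b'"
    using f_antimono[of a a' b b'] f_antimono[of a' a b' b] assms by fastforce
  then show "a = a'" using assms(3) by (auto simp: f_def split: if_splits)
qed

lemma f_range:
  assumes "a \<in> {1..n}" "b \<in> {1..n}"
  shows "f a b \<in> {1..n\<^sup>2}"
proof -
  have "0 \<le> n * (n - b)" "n * (n - b) \<le> n * (n - 1)"
    using assms by (auto intro!: mult_left_mono)
  moreover have "n * (n - 1) = n\<^sup>2 - n"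
    by (simp add: power2_eq_square algebra_simps)
  ultimately show ?thesis
    using f_block[OF assms(1), of b] unfolding atLeastAtMost_iff by linarith
qed

text \<open>The left side is \<open>f m m\<close>, the median of the numbers from 1 to
  \<open>n * n\<close>.\<close>

lemma common_residuum: "n * (n - m) + m = (n\<^sup>2 + 1) div 2"
proof -
  have "n\<^sup>2 + 1 = 2 * (n * (n - m) + m)"
    by (simp add: n_eq power2_eq_square algebra_simps)
  then show ?thesis by simp
qed

text \<open>With one entry per block, \<open>b j\<close> is the rank by \<open>f_antimono\<close>.
  Its sign is opposite to the one in \<open>f\<close>, so the \<open>a\<close>-part becomes
  \<open>a j - m\<close> and sums to 0; the rest gives \<open>n * n + m - n * m\<close>. Only the
  sum of \<open>a\<close> is prescribed, which admits the constant \<open>m\<close> of the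
  antidiagonal.\<close>

lemma residuum_transversal:
  assumes b: "bij_betw b {1..n} {1..n}"
    and a: "\<And>j. j \<in> {1..n} \<Longrightarrow> a j \<in> {1..n}" "(\<Sum>j\<in>{1..n}. a j) = n * m"
  shows "residuum (map (\<lambda>j. f (a j) (b j)) [1..n]) = (n\<^sup>2 + 1) div 2"
proof -
  have "residuum (map (\<lambda>j. f (a j) (b j)) [1..n]) =
      (\<Sum>j\<in>{1..n}. (if odd (b j) then 1 else - 1) * f (a j) (b j))"
    using a by (intro residuum_map_upto[OF b] less_imp_le f_antimono) auto
  also have "\<dots> = (\<Sum>j\<in>{1..n}. (a j - m) +
      (n * n + m) * (if odd (b j) then 1 else - 1) -
      n * ((if odd (b j) then 1 else - 1) * b j))"
    by (intro sum.cong) (auto simp: f_def algebra_simps)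
  also have "\<dots> = (\<Sum>j\<in>{1..n}. a j - m) +
      (n * n + m) * (\<Sum>j\<in>{1..n}. if odd (b j) then 1 else - 1) -
      n * (\<Sum>j\<in>{1..n}. (if odd (b j) then 1 else - 1) * b j)"
    by (simp only: sum.distrib sum_subtractf sum_distrib_left)
  also have "(\<Sum>j\<in>{1..n}. if odd (b j) then 1 else - 1) = (1 :: int)"
    using sum.reindex_bij_betw[OF b, of "\<lambda>k. if odd k then 1 else - 1 :: int"] sum_signs[OF m m_ge]
    by simp
  also have "(\<Sum>j\<in>{1..n}. (if odd (b j) then 1 else - 1) * b j) = m"
    using sum.reindex_bij_betw[OF b, of "\<lambda>k. (if odd k then 1 else - 1) * k"] sum_signed[OF m m_ge]
    by simp
  also have "(\<Sum>j\<in>{1..n}. a j - m) = 0"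
    using a(2) n by (simp add: sum_subtractf)
  finally show ?thesis
    unfolding common_residuum[symmetric] by (simp add: algebra_simps)
qed

text \<open>The entries are \<open>n\<close> consecutive numbers with \<open>n\<close> odd, so their
  alternating sum is their median.\<close>

lemma residuum_block: "residuum (map (\<lambda>j. f j m) [1..n]) = (n\<^sup>2 + 1) div 2"
proof -
  \<comment> \<open>In block \<open>m\<close> the entries increase with \<open>j\<close> if
    \<open>m\<close> is odd and decrease otherwise; \<open>p\<close> is the rank accordingly, and
    \<open>s\<close> is the sign inside \<open>f\<close>.\<close>
  define p where "p j = (if odd m then n + 1 - j else j)" for j
  define s :: int where "s = (if odd m then - 1 else 1)"
  have "bij_betw p {1..n} {1..n}"
    by (rule int_interval_bij) (auto simp: p_def inj_on_def)
  then have "residuum (map (\<lambda>j. f j m) [1..n]) =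
      (\<Sum>j\<in>{1..n}. (if odd (p j) then 1 else - 1) * f j m)"
    by (rule residuum_map_upto) (auto simp: p_def f_def split: if_splits)
  \<comment> \<open>As \<open>n + 1\<close> is even, \<open>p j\<close> has the parity of
    \<open>j\<close> in both cases. After summation the two terms \<open>s * m\<close>
    cancel.\<close>
  also have "\<dots> = (\<Sum>j\<in>{1..n}. (n * (n - m) + m + s * m) * (if odd j then 1 else - 1) -
      s * ((if odd j then 1 else - 1) * j))"
    using n_eq by (intro sum.cong) (auto simp: p_def f_def s_def algebra_simps)
  also have "\<dots> = n * (n - m) + m"
    using sum_signs[OF m m_ge] sum_signed[OF m m_ge]
    by (simp add: sum_subtractf flip: sum_distrib_left)
  finally show ?thesis by (simp add: common_residuum)
qed

section \<open>The index maps of the square\<close>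

definition a :: "int \<Rightarrow> int \<Rightarrow> int" where
  "a i j = (if even i \<longleftrightarrow> even j then (i + j) div 2 else wrap n ((i + j + n) div 2))"

definition b :: "int \<Rightarrow> int \<Rightarrow> int" where
  "b i j = (if even i \<longleftrightarrow> even j then (j - i) div 2 + m else wrap n ((j - i + n) div 2 + m))"

lemma index_range:
  assumes "i \<in> {1..n}" "j \<in> {1..n}"
  shows "a i j \<in> {1..n}" "b i j \<in> {1..n}"
proof -
  have w: "wrap n k \<in> {1..n}" for k
    using n by (intro wrap_props) auto
  have "(i + j) div 2 \<in> {1..n}"
    using assms unfolding atLeastAtMost_iff by linarith
  then show "a i j \<in> {1..n}"
    using w by (simp add: a_def)
  \<comment> \<open>Since \<open>n - 1 = 2 * (m - 1)\<close>, the half difference is at most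
    \<open>m - 1\<close> in absolute value, so the bounds are 1 and
    \<open>2 * m - 1 = n\<close>.\<close>
  have "(j - i) div 2 + m \<in> {1..n}"
    using assms m unfolding atLeastAtMost_iff by linarith
  then show "b i j \<in> {1..n}"
    using w by (simp add: b_def)
qed

text \<open>Doubling undoes the halving, which is exact because adding the odd \<open>n\<close>
  makes the numerator even for mixed parities. Modulo \<open>n\<close> this summand vanishes, so one
  linear congruence covers both cases.\<close>

lemma dvd_index:
  "n dvd 2 * a i j - (i + j)" "n dvd 2 * b i j - (j - i + 2 * m)"
proof -
  have w: "n dvd 2 * wrap n k - x" if "x + n = 2 * k" for k x
  proof -
    have "n dvd wrap n k - k" using n by (intro wrap_props) auto
    moreover have "2 * wrap n k - x = 2 * (wrap n k - k) + n" using that by simp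
    ultimately show ?thesis by (metis dvd_add dvd_mult dvd_refl)
  qed
  have "odd n" by (simp add: n_eq)
  have "n dvd 2 * wrap n ((i + j + n) div 2) - (i + j)" if "even i \<noteq> even j"
    using that \<open>odd n\<close> by (intro w) auto
  moreover have "2 * ((i + j) div 2) = i + j" if "even i = even j"
    using that by auto
  ultimately show "n dvd 2 * a i j - (i + j)" by (auto simp: a_def)
  have "n dvd 2 * wrap n ((j - i + n) div 2 + m) - (j - i + 2 * m)" if "even i \<noteq> even j"
    using that \<open>odd n\<close> by (intro w) auto
  moreover have "2 * ((j - i) div 2 + m) = j - i + 2 * m" if "even i = even j"
    using that by auto
  ultimately show "n dvd 2 * b i j - (j - i + 2 * m)" by (auto simp: b_def)
qed

lemma
  shows a_eq_dvd: "a i j = a i' j' \<Longrightarrow> n dvd (i + j) - (i' + j')"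
    and b_eq_dvd: "b i j = b i' j' \<Longrightarrow> n dvd (j - i) - (j' - i')"
  using dvd_diff[OF dvd_index(1)[of i' j'] dvd_index(1)[of i j]]
    dvd_diff[OF dvd_index(2)[of i' j'] dvd_index(2)[of i j]]
  by (auto simp: algebra_simps)

text \<open>The sum and the difference of the two congruences isolate \<open>j\<close> and
  \<open>i\<close> up to the factor 2, which is invertible modulo the odd \<open>n\<close>.\<close>

lemma index_inj:
  assumes "i \<in> {1..n}" "j \<in> {1..n}" "i' \<in> {1..n}" "j' \<in> {1..n}"
    and "a i j = a i' j'" "b i j = b i' j'"
  shows "i = i'" "j = j'"
proof -
  have "n dvd 2 * (j - j')" "n dvd 2 * (i - i')"
    using dvd_add[OF a_eq_dvd[OF assms(5)] b_eq_dvd[OF assms(6)]]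
      dvd_diff[OF a_eq_dvd[OF assms(5)] b_eq_dvd[OF assms(6)]]
    by (auto simp: algebra_simps)
  moreover have "coprime n 2" by (simp add: n_eq)
  ultimately have "n dvd j - j'" "n dvd i - i'"
    by (auto simp only: coprime_dvd_mult_right_iff)
  then show "i = i'" "j = j'" using assms int_interval_dvd_diff by auto
qed

text \<open>With one index fixed, the congruences compare only the other one, which gives
  injectivity. Bijectivity of \<open>b\<close> provides the ranks, that of \<open>a\<close> the sum
  \<open>n * m\<close>.\<close>

lemma index_row_bij:
  assumes "i \<in> {1..n}"
  shows "bij_betw (a i) {1..n} {1..n}" "bij_betw (b i) {1..n} {1..n}"
proof -
  have "inj_on (a i) {1..n}" "inj_on (b i) {1..n}"
    using a_eq_dvd[of i _ i] b_eq_dvd[of i _ i]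
    by (auto intro!: inj_onI int_interval_dvd_diff[of n])
  then show "bij_betw (a i) {1..n} {1..n}" "bij_betw (b i) {1..n} {1..n}"
    using assms index_range by (auto intro!: int_interval_bij)
qed

lemma index_col_bij:
  assumes "j \<in> {1..n}"
  shows "bij_betw (\<lambda>i. a i j) {1..n} {1..n}" "bij_betw (\<lambda>i. b i j) {1..n} {1..n}"
proof -
  have "inj_on (\<lambda>i. a i j) {1..n}" "inj_on (\<lambda>i. b i j) {1..n}"
    using a_eq_dvd[of _ j _ j] b_eq_dvd[of _ j _ j]
    by (auto intro!: inj_onI int_interval_dvd_diff[of n] simp: dvd_diff_commute)
  then show "bij_betw (\<lambda>i. a i j) {1..n} {1..n}" "bij_betw (\<lambda>i. b i j) {1..n} {1..n}"
    using assms index_range by (auto intro!: int_interval_bij)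
qed

section \<open>Assembling the magic square\<close>

lemma bij_square:
  "bij_betw (\<lambda>(i, j). f (a i j) (b i j)) ({1..n} \<times> {1..n}) {1..n\<^sup>2}"
proof -
  let ?F = "\<lambda>(i, j). f (a i j) (b i j)"
  have "inj_on ?F ({1..n} \<times> {1..n})"
  proof (rule inj_onI, unfold split_paired_all mem_Times_iff fst_conv snd_conv prod.case prod.inject,
      elim conjE)
    fix i j i' j'
    assume ij: "i \<in> {1..n}" "j \<in> {1..n}" "i' \<in> {1..n}" "j' \<in> {1..n}"
      and eq: "f (a i j) (b i j) = f (a i' j') (b i' j')"
    have "a i j = a i' j'" "b i j = b i' j'"
      using f_inj[OF _ _ eq] index_range ij by blast+
    then show "i = i' \<and> j = j'" using index_inj[OF ij] by blast
  qed
  moreover have "?F ` ({1..n} \<times> {1..n}) \<subseteq> {1..n\<^sup>2}"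
    by (auto simp: f_range index_range simp del: atLeastAtMost_iff)
  \<comment> \<open>Equal finite cardinalities make the injection surjective.\<close>
  moreover have "card ({1..n} \<times> {1..n}) = card {1..n\<^sup>2}"
    using n by (simp add: card_cartesian_product power2_eq_square nat_mult_distrib)
  ultimately show ?thesis
    by (intro bij_betw_imageI card_subset_eq) (auto simp only: card_image finite_atLeastAtMost_int)
qed

lemma residuum_lines:
  assumes "x \<in> lines_of n (\<lambda>i j. f (a i j) (b i j))"
  shows "residuum x = (n\<^sup>2 + 1) div 2"
proof -
  have sum: "(\<Sum>j\<in>{1..n}. p j) = n * m" if "bij_betw p {1..n} {1..n}" for p
    using sum.reindex_bij_betw[OF that, of "\<lambda>k. k"] sum_interval[OF m m_ge] by simp
  consider i where "i \<in> {1..n}" "x = map (\<lambda>j. f (a i j) (b i j)) [1..n]"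
    | j where "j \<in> {1..n}" "x = map (\<lambda>i. f (a i j) (b i j)) [1..n]"
    | "x = map (\<lambda>i. f (a i i) (b i i)) [1..n]"
    | "x = map (\<lambda>i. f (a i (n + 1 - i)) (b i (n + 1 - i))) [1..n]"
    using assms by (auto simp: lines_of_def)
  then show ?thesis
  proof cases
    case 1
    then show ?thesis using residuum_transversal sum index_row_bij index_range by simp
  next
    case 2
    then show ?thesis using residuum_transversal sum index_col_bij index_range by simp
  next
    case 3
    \<comment> \<open>Here \<open>a i i = i\<close> and \<open>b i i = m\<close>.\<close>
    then show ?thesis using residuum_block by (simp add: a_def b_def)
  next
    case 4
    \<comment> \<open>The indices add up to \<open>2 * m\<close>, so they have equal parity and no
      wrapping occurs.\<close>
    have "a i (n + 1 - i) = m" "b i (n + 1 - i) = n + 1 - i" for i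
      by (auto simp: a_def b_def simp flip: m)
    moreover have "bij_betw (\<lambda>i. n + 1 - i) {1..n} {1..n}"
      by (rule int_interval_bij) (auto simp: inj_on_def)
    ultimately show ?thesis using 4 residuum_transversal[of "\<lambda>i. n + 1 - i" "\<lambda>i. m"] m n by simp
  qed
qed

end

text \<open>This allows replacing \<open>M\<close>, which is specified only for indices in
  \<open>{1..n}\<close>, by the explicit formula.\<close>

lemma lines_of_cong:
  assumes "\<And>i j. i \<in> {1..n} \<Longrightarrow> j \<in> {1..n} \<Longrightarrow> A i j = B i j"
  shows "lines_of n A = lines_of n B"
proof -
  have "(\<lambda>i. map (\<lambda>j. A i j) [1..n]) ` {1..n} = (\<lambda>i. map (\<lambda>j. B i j) [1..n]) ` {1..n}"
    "(\<lambda>j. map (\<lambda>i. A i j) [1..n]) ` {1..n} = (\<lambda>j. map (\<lambda>i. B i j) [1..n]) ` {1..n}"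
    using assms by (auto intro!: image_cong)
  moreover have "map (\<lambda>i. A i i) [1..n] = map (\<lambda>i. B i i) [1..n]"
    "map (\<lambda>i. A i (n + 1 - i)) [1..n] = map (\<lambda>i. B i (n + 1 - i)) [1..n]"
    using assms by auto
  ultimately show ?thesis
    unfolding lines_of_def Setcompr_eq_image by argo
qed

theorem proposition1:
  fixes n m :: int and f M :: "int \<Rightarrow> int \<Rightarrow> int"
  assumes "odd n" and "n \<ge> 3"
    and "m = (n + 1) div 2"
    and "\<And>i j. f i j = (m - i) * (- 1) ^ nat \<bar>j\<bar> + n * (n - j) + m"
    and "\<And>i j. i \<in> {1..n} \<Longrightarrow> j \<in> {1..n} \<Longrightarrow>
      M i j = (if even i \<longleftrightarrow> even j
               then f ((i + j) div 2) ((j - i) div 2 + m)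
               else f (wrap n ((i + j + n) div 2)) (wrap n ((j - i + n) div 2 + m)))"
  shows "magic_square_of_subtraction n M \<and> square_residuum n M = (n\<^sup>2 + 1) div 2"
proof -
  interpret S: subtraction_square n m
    using assms(1-3) by unfold_locales (auto elim!: oddE)
  \<comment> \<open>\<open>nat \<bar>j\<bar>\<close> has the parity of \<open>j\<close>, so the
    power equals the sign chosen by cases.\<close>
  have f: "f = S.f"
    by (intro ext) (auto simp: assms(4) S.f_def minus_one_power_iff even_nat_iff)
  have M: "M i j = S.f (S.a i j) (S.b i j)" if "i \<in> {1..n}" "j \<in> {1..n}" for i j
    using assms(5)[OF that] by (simp add: f S.a_def S.b_def)
  have "bij_betw (\<lambda>(i, j). M i j) ({1..n} \<times> {1..n}) {1..n\<^sup>2}"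
    using S.bij_square by (rule bij_betw_cong[THEN iffD1, rotated]) (auto simp: M)
  moreover have res: "residuum x = (n\<^sup>2 + 1) div 2" if "x \<in> lines_of n M" for x
    using that S.residuum_lines lines_of_cong[of n M, OF M] by simp
  \<comment> \<open>The existence of a line makes the common residuum unique, as \<open>THE\<close>
    requires.\<close>
  moreover have "map (\<lambda>i. M i i) [1..n] \<in> lines_of n M"
    by (simp add: lines_of_def)
  ultimately show ?thesis
    using assms(2) unfolding magic_square_of_subtraction_def square_residuum_def
    by (auto intro!: the_equality)
qed

end
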